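(* In the setting described in the context, let $0\le\varepsilon<1-E_{\min}$ with $g_{\varepsilon/2}>0$, and let $\gamma>0$. If $\phi_\varepsilon(\mathcal S)$ and $\omega(\mathcal S)$ do not correlate negatively, i.e. $\langle\phi_\varepsilon(\mathcal S)\,\omega(\mathcal S)\rangle_{\mathcal S}-\langle\phi_\varepsilon(\mathcal S)\rangle_{\mathcal S}\langle\omega(\mathcal S)\rangle_{\mathcal S}\ge0$, then $$\mathrm{Prob}\{\phi_\varepsilon(\mathcal S)\ge\gamma\}\le\frac1\gamma\,\frac{\int_{E_{\min}+\varepsilon}^1(1-E)^nD(E)\,dE}{\int_0^1(1-E)^nD(E)\,dE}\le\frac{1}{\gamma\,g_{\varepsilon/2}}\,e^{-\frac{\varepsilon}{2}n},$$ where the probability is over the random draw of $\mathcal S$.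
   Context: Setting. $P(x,y)$ is a probability distribution on pairs (input $x$, label $y$). $\mathcal W\subseteq\mathbb R^N$ is a compact set of non-zero Lebesgue measure; each $w\in\mathcal W$ determines a classifier $h_w$ mapping inputs to labels, and $\mathcal H_{\mathcal W}=\{h_w: w\in\mathcal W\}$ has finite VC-dimension. The loss is $L(y,h_w(x))\in\{0,1\}$, equal to $0$ if $h_w(x)=y$ and $1$ otherwise. The map $(w,x,y)\mapsto L(y,h_w(x))$ is jointly measurable. The true error of $w$ is $E(w)=\int L(y,h_w(x))\,dP(x,y)\in[0,1]$; it is integrable on $\mathcal W$, and $E_{\min}=\min_{w\in\mathcal W}E(w)$ (assumed attained). Training sets. $n\ge 1$ is an integer and $\mathcal S=\{(x_1,y_1),\dots,(x_n,y_n)\}$ is drawn i.i.d. from $P(x,y)$, i.e. $\mathcal S\sim P(x,y)^n$. The training error is $E_{\mathcal S}(w)=\frac1n\sum_{i=1}^nL(y_i,h_w(x_i))$. $\langle\cdot\rangle_{\mathcal S}$ denotes expectation over $\mathcal S$. Parameter sets and volumes, for $\varepsilon\ge0$: $\mathcal W_\varepsilon=\{w\in\mathcal W:E(w)\ge E_{\min}+\varepsilon\}$; $\mathcal W(\mathcal S)=\{w\in\mathcal W:E_{\mathcal S}(w)=0\}$; $\mathcal W_\varepsilon(\mathcal S)=\{w\in\mathcal W_\varepsilon:E_{\mathcal S}(w)=0\}$. With $|\cdot|$ Lebesgue measure, $\Omega=|\mathcal W|$, $\Omega_\varepsilon=|\mathcal W_\varepsilon|$, $\omega(\mathcal S)=|\mathcal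 W(\mathcal S)|$, $\omega_\varepsilon(\mathcal S)=|\mathcal W_\varepsilon(\mathcal S)|$. Over-parameterization assumption: $\omega(\mathcal S)>0$ for almost all $\mathcal S$ of size $n$. The fraction of good classifiers is $g_\varepsilon=(\Omega-\Omega_\varepsilon)/\Omega$, and the fraction of bad classifiers among the global minima is $\phi_\varepsilon(\mathcal S)=\omega_\varepsilon(\mathcal S)/\omega(\mathcal S)$ (defined for almost all $\mathcal S$). Density of classifiers. $D(E)$ is the density on $[0,1]$ (with $D(E)=0$ for $E<E_{\min}$) such that $\Omega_\varepsilon=\int_{E_{\min}+\varepsilon}^1D(E)\,dE$ for each $0\le\varepsilon\le1-E_{\min}$. It is understood in the generalized sense: $D(E)\,dE$ is the image of Lebesgue measure on $\mathcal W$ under $w\mapsto E(w)$, point masses are allowed, and $\int_{E_{\min}+\varepsilon}^1$ and $\int_0^1$ include both endpoints. *)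

theory Defs
  imports "HOL-Probability.Probability" "HOL-Library.Extended_Nat"
begin

(* Shattering for classifiers with an arbitrary label type: relative to some reference
   labelling f of C, every pattern of agreement and disagreement with f on C is realised.
   Equivalently, the 0-1 loss class of H shatters the labelled points (x, f x).
   For two labels this is the usual notion; see shatters_bool. *)
definition shatters :: "('x \<Rightarrow> 'y) set \<Rightarrow> 'x set \<Rightarrow> bool" where
  "shatters H C \<longleftrightarrow> (\<exists>f. \<forall>T\<subseteq>C. \<exists>h\<in>H. \<forall>x\<in>C. h x = f x \<longleftrightarrow> x \<in> T)"

definition vc_dim :: "('x \<Rightarrow> 'y) set \<Rightarrow> enat" where
  "vc_dim H = (SUP C\<in>{C. finite C \<and> shatters H C}. enat (card C))"

lemma shatters_bool:
  fixes H :: "('x \<Rightarrow> bool) set"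
  shows "shatters H C \<longleftrightarrow> (\<forall>T\<subseteq>C. \<exists>h\<in>H. {x\<in>C. h x} = T)"
proof
  assume "shatters H C"
  then obtain f where f: "\<And>T. T \<subseteq> C \<Longrightarrow> \<exists>h\<in>H. \<forall>x\<in>C. h x = f x \<longleftrightarrow> x \<in> T"
    unfolding shatters_def by blast
  show "\<forall>T\<subseteq>C. \<exists>h\<in>H. {x\<in>C. h x} = T"
  proof (intro allI impI)
    fix T assume T: "T \<subseteq> C"
    have "{x\<in>C. f x \<longleftrightarrow> x \<in> T} \<subseteq> C" by blast
    from f[OF this] obtain h where "h \<in> H"
      and "\<forall>x\<in>C. h x = f x \<longleftrightarrow> x \<in> {x\<in>C. f x \<longleftrightarrow> x \<in> T}"
      by blast
    then have "h \<in> H" "{x\<in>C. h x} = T" using T by auto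
    then show "\<exists>h\<in>H. {x\<in>C. h x} = T" by blast
  qed
next
  assume R: "\<forall>T\<subseteq>C. \<exists>h\<in>H. {x\<in>C. h x} = T"
  have "\<exists>h\<in>H. \<forall>x\<in>C. h x = True \<longleftrightarrow> x \<in> T" if "T \<subseteq> C" for T
    using R that by blast
  then show "shatters H C"
    unfolding shatters_def by (intro exI[of _ "\<lambda>_. True"]) blast
qed

definition loss :: "'y \<Rightarrow> 'y \<Rightarrow> real" where
  "loss y y' = (if y' = y then 0 else 1)"

definition true_error :: "('x \<times> 'y) measure \<Rightarrow> ('w \<Rightarrow> 'x \<Rightarrow> 'y) \<Rightarrow> 'w \<Rightarrow> real" where
  "true_error P h w = (LINT z|P. loss (snd z) (h w (fst z)))"

definition min_error :: "('x \<times> 'y) measure \<Rightarrow> ('w \<Rightarrow> 'x \<Rightarrow> 'y) \<Rightarrow> 'w set \<Rightarrow> real" where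
  "min_error P h W = (INF w\<in>W. true_error P h w)"

(* A training set of size n is a function S on the index set {..<n}. *)
definition sample_dist :: "('x \<times> 'y) measure \<Rightarrow> nat \<Rightarrow> (nat \<Rightarrow> 'x \<times> 'y) measure" where
  "sample_dist P n = PiM {..<n} (\<lambda>_. P)"

definition training_error ::
  "nat \<Rightarrow> ('w \<Rightarrow> 'x \<Rightarrow> 'y) \<Rightarrow> (nat \<Rightarrow> 'x \<times> 'y) \<Rightarrow> 'w \<Rightarrow> real" where
  "training_error n h S w = (\<Sum>i<n. loss (snd (S i)) (h w (fst (S i)))) / real n"

definition bad_params ::
  "('x \<times> 'y) measure \<Rightarrow> ('w \<Rightarrow> 'x \<Rightarrow> 'y) \<Rightarrow> 'w set \<Rightarrow> real \<Rightarrow> 'w set" where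
  "bad_params P h W \<epsilon> = {w \<in> W. true_error P h w \<ge> min_error P h W + \<epsilon>}"

definition global_minima ::
  "nat \<Rightarrow> ('w \<Rightarrow> 'x \<Rightarrow> 'y) \<Rightarrow> 'w set \<Rightarrow> (nat \<Rightarrow> 'x \<times> 'y) \<Rightarrow> 'w set" where
  "global_minima n h W S = {w \<in> W. training_error n h S w = 0}"

definition bad_global_minima ::
  "('x \<times> 'y) measure \<Rightarrow> nat \<Rightarrow> ('w \<Rightarrow> 'x \<Rightarrow> 'y) \<Rightarrow> 'w set \<Rightarrow> real \<Rightarrow> (nat \<Rightarrow> 'x \<times> 'y) \<Rightarrow> 'w set" where
  "bad_global_minima P n h W \<epsilon> S = {w \<in> bad_params P h W \<epsilon>. training_error n h S w = 0}"

definition minima_volume ::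
  "nat \<Rightarrow> ('w::euclidean_space \<Rightarrow> 'x \<Rightarrow> 'y) \<Rightarrow> 'w set \<Rightarrow> (nat \<Rightarrow> 'x \<times> 'y) \<Rightarrow> real" where
  "minima_volume n h W S = measure lebesgue (global_minima n h W S)"

definition bad_minima_volume ::
  "('x \<times> 'y) measure \<Rightarrow> nat \<Rightarrow> ('w::euclidean_space \<Rightarrow> 'x \<Rightarrow> 'y) \<Rightarrow> 'w set \<Rightarrow> real
    \<Rightarrow> (nat \<Rightarrow> 'x \<times> 'y) \<Rightarrow> real" where
  "bad_minima_volume P n h W \<epsilon> S = measure lebesgue (bad_global_minima P n h W \<epsilon> S)"

definition good_fraction ::
  "('x \<times> 'y) measure \<Rightarrow> ('w::euclidean_space \<Rightarrow> 'x \<Rightarrow> 'y) \<Rightarrow> 'w set \<Rightarrow> real \<Rightarrow> real" where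
  "good_fraction P h W \<epsilon> =
    (measure lebesgue W - measure lebesgue (bad_params P h W \<epsilon>)) / measure lebesgue W"

(* Where minima_volume vanishes (a null set of S under over-parameterization) this is x / 0 = 0. *)
definition bad_minima_fraction ::
  "('x \<times> 'y) measure \<Rightarrow> nat \<Rightarrow> ('w::euclidean_space \<Rightarrow> 'x \<Rightarrow> 'y) \<Rightarrow> 'w set \<Rightarrow> real
    \<Rightarrow> (nat \<Rightarrow> 'x \<times> 'y) \<Rightarrow> real" where
  "bad_minima_fraction P n h W \<epsilon> S = bad_minima_volume P n h W \<epsilon> S / minima_volume n h W S"

(* The generalized density of classifiers D(E) dE, as a measure on the real line that may have
   atoms: the image of Lebesgue measure on W under the true error. *)
definition classifier_density ::
  "('x \<times> 'y) measure \<Rightarrow> ('w::euclidean_space \<Rightarrow> 'x \<Rightarrow> 'y) \<Rightarrow> 'w set \<Rightarrow> real measure" where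
  "classifier_density P h W = distr (lebesgue_on W) borel (true_error P h)"

end

(* By Tonelli, the expected volume of the parameters in a set B that fit every training example
   is the integral of (1 - E w)^n over w in B, because a fixed w fits n independent examples with
   probability (1 - E w)^n. Markov's inequality and the correlation hypothesis bound the
   probability by the quotient of the expected bad and the expected total volume. In this quotient
   the numerator is at most (1 - E_min - \<epsilon>)^n |W| and the denominator is at least
   (1 - E_min - \<epsilon>/2)^n (|W| - |W_(\<epsilon>/2)|). *)

theory Submission
  imports Defs
begin

text \<open>Read \<open>A\<close> as the relation "\<open>w\<close> fits the example". For fixed
  \<open>w\<close> its section is the event of fitting one example, and independence makes the
  measure of the box a product of \<open>n\<close> equal factors.\<close>

lemma emeasure_PiM_Pair_vimage:
  assumes P: "prob_space P" and A: "A \<in> sets (M \<Otimes>\<^sub>M P)"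
  shows "emeasure (PiM {..<n::nat} (\<lambda>_. P)) (PiE {..<n} (\<lambda>_. Pair w -` A))
    = ennreal (measure P (Pair w -` A) ^ n)"
proof -
  interpret P: prob_space P by fact
  interpret product_sigma_finite "\<lambda>_::nat. P" ..
  have "emeasure (PiM {..<n} (\<lambda>_. P)) (PiE {..<n} (\<lambda>_. Pair w -` A))
      = (\<Prod>i<n. emeasure P (Pair w -` A))"
    using sets_Pair1[OF A] by (intro emeasure_PiM) auto
  then show ?thesis
    by (simp add: P.emeasure_eq_measure ennreal_power)
qed

text \<open>Tonelli: both integrals are the product measure of one set of pairs
  \<open>(w, S)\<close>. Slicing it at \<open>S\<close> gives the volume \<open>V S\<close>; slicing
  it at \<open>w\<close> gives the probability that \<open>w\<close> fits the whole sample.\<close>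

lemma integral_measure_common_fit:
  fixes n :: nat
  assumes M: "finite_measure M" and P: "prob_space P"
    and A: "A \<in> sets (M \<Otimes>\<^sub>M P)" and B: "B \<in> sets M"
  defines "V \<equiv> (\<lambda>S. measure M {w \<in> B. \<forall>i<n. (w, S i) \<in> A})"
  shows "V \<in> borel_measurable (PiM {..<n} (\<lambda>_. P))"
    and "(LINT S|PiM {..<n} (\<lambda>_. P). V S) = (LINT w:B|M. measure P (Pair w -` A) ^ n)"
proof -
  interpret M: finite_measure M by fact
  interpret P1: prob_space P by fact
  let ?N = "PiM {..<n} (\<lambda>_. P)"
  interpret N: prob_space ?N by (intro prob_space_PiM P)
  interpret pair_sigma_finite M ?N ..
  \<comment> \<open>\<open>Q\<close> is the set to be sliced both ways. The quantifier is bounded by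
    the finite set \<open>{..<n}\<close> so that measurability of \<open>Q\<close> reduces to that
    of the single constraints.\<close>
  define Q where "Q = {p \<in> space (M \<Otimes>\<^sub>M ?N). fst p \<in> B \<and> (\<forall>i\<in>{..<n}. (fst p, snd p i) \<in> A)}"
  have [measurable]: "A \<in> sets (M \<Otimes>\<^sub>M P)" "B \<in> sets M" by fact+
  have "{p \<in> space (M \<Otimes>\<^sub>M ?N). (fst p, snd p i) \<in> A} \<in> sets (M \<Otimes>\<^sub>M ?N)" if "i < n" for i
  proof -
    have [measurable]: "(\<lambda>p. snd p i) \<in> measurable (M \<Otimes>\<^sub>M ?N) P"
      using that by (intro measurable_compose[OF measurable_snd measurable_component_singleton]) auto
    show ?thesis by measurable
  qed
  then have Q: "Q \<in> sets (M \<Otimes>\<^sub>M ?N)"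
    unfolding Q_def
    by (intro sets.sets_Collect_conj sets.sets_Collect_finite_All) (auto, measurable)
  have V: "V S = measure M ((\<lambda>w. (w, S)) -` Q)" if "S \<in> space ?N" for S
    unfolding V_def Q_def
    using that sets.sets_into_space[OF B] by (intro arg_cong[where f="measure M"]) (auto simp: space_pair_measure)
  have eV: "ennreal (V S) = emeasure M ((\<lambda>w. (w, S)) -` Q)" if "S \<in> space ?N" for S
    using V[OF that] by (simp add: M.emeasure_eq_measure)
  have "(\<lambda>S. enn2real (emeasure M ((\<lambda>w. (w, S)) -` Q))) \<in> borel_measurable ?N"
    using measurable_emeasure_Pair2[OF Q] by measurable
  then show meas: "V \<in> borel_measurable ?N"
    by (subst measurable_cong[where g="\<lambda>S. enn2real (emeasure M ((\<lambda>w. (w, S)) -` Q))"])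
      (auto simp: V measure_def)
  \<comment> \<open>For \<open>w\<close> in \<open>B\<close> the slice is exactly the box
    \<open>PiE\<close>, because points of the sample space are extensional functions. The indicator
    covers \<open>w\<close> outside \<open>B\<close>, where the slice is empty.\<close>
  have sec: "emeasure ?N (Pair w -` Q) = ennreal (measure P (Pair w -` A) ^ n * indicator B w)"
    if "w \<in> space M" for w
  proof (cases "w \<in> B")
    case True
    have "Pair w -` Q = PiE {..<n} (\<lambda>_. Pair w -` A)"
      using True that sets.sets_into_space[OF A]
      unfolding Q_def by (auto simp: space_pair_measure space_PiM PiE_iff extensional_def)
    then show ?thesis
      using True by (simp add: emeasure_PiM_Pair_vimage[OF P A])
  next
    case False
    then have "Pair w -` Q = {}" by (auto simp: Q_def)
    then show ?thesis using False by simp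
  qed
  have pm: "(\<lambda>w. measure P (Pair w -` A)) \<in> borel_measurable M"
    using P1.measurable_emeasure_Pair[OF A] unfolding measure_def by measurable
  have "(LINT S|?N. V S) = enn2real (\<integral>\<^sup>+S. ennreal (V S) \<partial>?N)"
    using meas by (intro integral_eq_nn_integral) (auto simp: V_def)
  also have "(\<integral>\<^sup>+S. ennreal (V S) \<partial>?N) = (\<integral>\<^sup>+S. emeasure M ((\<lambda>w. (w, S)) -` Q) \<partial>?N)"
    by (intro nn_integral_cong eV)
  also have "\<dots> = emeasure (M \<Otimes>\<^sub>M ?N) Q"
    by (rule emeasure_pair_measure_alt2[OF Q, symmetric])
  also have "\<dots> = (\<integral>\<^sup>+w. emeasure ?N (Pair w -` Q) \<partial>M)"
    by (rule N.emeasure_pair_measure_alt[OF Q])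
  also have "\<dots> = (\<integral>\<^sup>+w. ennreal (measure P (Pair w -` A) ^ n * indicator B w) \<partial>M)"
    by (intro nn_integral_cong sec)
  also have "enn2real \<dots> = (LINT w|M. measure P (Pair w -` A) ^ n * indicator B w)"
    using pm by (intro integral_eq_nn_integral[symmetric]) (auto intro!: borel_measurable_times borel_measurable_power)
  finally show "(LINT S|?N. V S) = (LINT w:B|M. measure P (Pair w -` A) ^ n)"
    by (simp add: set_lebesgue_integral_def mult.commute)
qed

text \<open>Since \<open>a - \<epsilon> / 2\<close> is at most 1, multiplying it by
  \<open>1 - \<epsilon> / 2\<close> lowers it by at most \<open>\<epsilon> / 2\<close>, so the
  product stays above \<open>a - \<epsilon>\<close>. Then \<open>1 - x \<le> exp (- x)\<close> and
  taking powers give the exponential rate.\<close>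

lemma power_shift_le_exp:
  fixes a \<epsilon> :: real
  assumes "0 \<le> \<epsilon>" "\<epsilon> \<le> a" "a \<le> 1"
  shows "(a - \<epsilon>) ^ n \<le> (a - \<epsilon> / 2) ^ n * exp (- (\<epsilon> / 2) * real n)"
proof -
  have "a - \<epsilon> \<le> (a - \<epsilon> / 2) * (1 - \<epsilon> / 2)"
  proof -
    have "(a - \<epsilon> / 2) * (\<epsilon> / 2) \<le> 1 * (\<epsilon> / 2)"
      using assms by (intro mult_right_mono) auto
    then show ?thesis by (simp add: algebra_simps)
  qed
  also have "\<dots> \<le> (a - \<epsilon> / 2) * exp (- (\<epsilon> / 2))"
    using assms exp_ge_add_one_self[of "- (\<epsilon> / 2)"] by (intro mult_left_mono) auto
  finally have "(a - \<epsilon>) ^ n \<le> ((a - \<epsilon> / 2) * exp (- (\<epsilon> / 2))) ^ n"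
    using assms by (intro power_mono) auto
  then show ?thesis
    by (simp add: power_mult_distrib exp_of_nat2_mult[symmetric])
qed

text \<open>The integrand is compared pointwise with the constant \<open>(1 - t) ^ n\<close> on
  \<open>B\<close>. Monotonicity of the power needs a nonnegative smaller base: for the upper bound
  this comes from the range of \<open>E\<close>, for the lower bound from
  \<open>t \<le> 1\<close>.\<close>

lemma set_integral_power_bounds:
  fixes E :: "'a \<Rightarrow> real"
  assumes M: "finite_measure M" and E: "E \<in> borel_measurable M"
    and range: "\<And>w. w \<in> space M \<Longrightarrow> 0 \<le> E w \<and> E w \<le> 1"
    and B: "B \<in> sets M"
  shows set_integrable_power: "set_integrable M B (\<lambda>w. (1 - E w) ^ n)"
    and set_integral_power_le:
      "(\<And>w. w \<in> B \<Longrightarrow> t \<le> E w) \<Longrightarrow> (LINT w:B|M. (1 - E w) ^ n) \<le> (1 - t) ^ n * measure M B"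
    and set_integral_power_ge:
      "(\<And>w. w \<in> B \<Longrightarrow> E w \<le> t) \<Longrightarrow> t \<le> 1 \<Longrightarrow>
        (1 - t) ^ n * measure M B \<le> (LINT w:B|M. (1 - E w) ^ n)"
proof -
  interpret finite_measure M by fact
  have sub: "B \<subseteq> space M" by (rule sets.sets_into_space[OF B])
  note [measurable] = E B
  have "integrable M (\<lambda>w. (1 - E w) ^ n)"
  proof (rule integrable_const_bound)
    show "AE w in M. norm ((1 - E w) ^ n) \<le> 1"
      using range by (intro AE_I2) (simp add: power_le_one)
  qed measurable
  then show int: "set_integrable M B (\<lambda>w. (1 - E w) ^ n)"
    unfolding set_integrable_def by (intro integrable_mult_indicator B)
  have int': "set_integrable M B (\<lambda>w. (1 - t) ^ n)"
    unfolding set_integrable_def by (intro integrable_mult_indicator B) simp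
  have const: "(LINT w:B|M. (1 - t) ^ n) = (1 - t) ^ n * measure M B"
    using sub by (simp add: set_lebesgue_integral_def mult.commute Int_absorb1)
  show "(LINT w:B|M. (1 - E w) ^ n) \<le> (1 - t) ^ n * measure M B" if "\<And>w. w \<in> B \<Longrightarrow> t \<le> E w"
    unfolding const[symmetric]
    using that range sub by (intro set_integral_mono int int' power_mono) auto
  show "(1 - t) ^ n * measure M B \<le> (LINT w:B|M. (1 - E w) ^ n)"
    if "\<And>w. w \<in> B \<Longrightarrow> E w \<le> t" "t \<le> 1"
    unfolding const[symmetric]
    using that range sub by (intro set_integral_mono int int' power_mono) auto
qed

text \<open>Losses are nonnegative, so their sum vanishes only termwise. This turns a global minimum
  into the conjunction over examples that \<open>integral_measure_common_fit\<close>
  handles.\<close>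

lemma training_error_eq_0_iff:
  assumes "n \<ge> 1"
  shows "training_error n h S w = 0 \<longleftrightarrow> (\<forall>i<n. loss (snd (S i)) (h w (fst (S i))) = 0)"
proof -
  have "training_error n h S w = 0 \<longleftrightarrow> (\<Sum>i<n. loss (snd (S i)) (h w (fst (S i)))) = 0"
    using assms by (simp add: training_error_def)
  also have "\<dots> \<longleftrightarrow> (\<forall>i<n. loss (snd (S i)) (h w (fst (S i))) = 0)"
    by (subst sum_nonneg_eq_0_iff) (auto simp: loss_def)
  finally show ?thesis .
qed

text \<open>Change of variables for an image measure. The set \<open>I\<close> is pulled back as it
  stands, so atoms at the endpoints of a closed interval are counted.\<close>

lemma set_integral_classifier_density:
  assumes "true_error P h \<in> borel_measurable (lebesgue_on W)"
    and "f \<in> borel_measurable borel" and "I \<in> sets borel" and W: "W \<in> sets lebesgue"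
  shows "(LINT E:I|classifier_density P h W. (f E :: real))
    = (LINT w:{w \<in> W. true_error P h w \<in> I}|lebesgue_on W. f (true_error P h w))"
proof -
  note [measurable] = assms(1-3)
  have "(LINT E:I|classifier_density P h W. f E)
      = (LINT w|lebesgue_on W. indicator I (true_error P h w) *\<^sub>R f (true_error P h w))"
    unfolding classifier_density_def set_lebesgue_integral_def
    by (rule integral_distr) measurable
  also have "\<dots> = (LINT w:{w \<in> W. true_error P h w \<in> I}|lebesgue_on W. f (true_error P h w))"
    unfolding set_lebesgue_integral_def
    using W by (intro Bochner_Integration.integral_cong) (auto simp: indicator_def)
  finally show ?thesis .
qed

theorem mainTheorem4:
  fixes P :: "('x \<times> 'y) measure"
    and W :: "(real ^ 'N) set"
    and h :: "real ^ 'N \<Rightarrow> 'x \<Rightarrow> 'y"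
    and n :: nat
    and \<epsilon> \<gamma> :: real
  assumes "prob_space P"
    and "compact W"
    and "measure lebesgue W \<noteq> 0"
    and "vc_dim (h ` W) < \<infinity>"
    and "(\<lambda>(w, x, y). loss y (h w x)) \<in> borel_measurable (lebesgue_on W \<Otimes>\<^sub>M P)"
    and "integrable (lebesgue_on W) (true_error P h)"
    and "\<exists>w\<in>W. true_error P h w = min_error P h W"
    and "n \<ge> 1"
    and "AE S in sample_dist P n. minima_volume n h W S > 0"
    and "0 \<le> \<epsilon>"
    and "\<epsilon> < 1 - min_error P h W"
    and "good_fraction P h W (\<epsilon> / 2) > 0"
    and "\<gamma> > 0"
    and "(LINT S|sample_dist P n. bad_minima_fraction P n h W \<epsilon> S * minima_volume n h W S)
          - (LINT S|sample_dist P n. bad_minima_fraction P n h W \<epsilon> S)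
            * (LINT S|sample_dist P n. minima_volume n h W S) \<ge> 0"
  shows "measure (sample_dist P n)
            {S \<in> space (sample_dist P n). bad_minima_fraction P n h W \<epsilon> S \<ge> \<gamma>}
          \<le> 1 / \<gamma> * ((LINT E:{min_error P h W + \<epsilon>..1}|classifier_density P h W. (1 - E) ^ n)
                     / (LINT E:{0..1}|classifier_density P h W. (1 - E) ^ n))
      \<and> 1 / \<gamma> * ((LINT E:{min_error P h W + \<epsilon>..1}|classifier_density P h W. (1 - E) ^ n)
                 / (LINT E:{0..1}|classifier_density P h W. (1 - E) ^ n))
          \<le> 1 / (\<gamma> * good_fraction P h W (\<epsilon> / 2)) * exp (- (\<epsilon> / 2) * real n)"
proof -
  let ?M = "lebesgue_on W"
  let ?N = "sample_dist P n"
  let ?E = "true_error P h"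
  let ?m = "min_error P h W"
  let ?\<omega> = "minima_volume n h W"
  let ?\<beta> = "bad_minima_volume P n h W \<epsilon>"
  let ?\<phi> = "bad_minima_fraction P n h W \<epsilon>"
  interpret P: prob_space P by fact
  interpret N: prob_space ?N
    unfolding sample_dist_def by (intro prob_space_PiM assms)
  have W: "W \<in> lmeasurable" by (rule lmeasurable_compact) fact
  then have Ws: "W \<in> sets lebesgue" by auto
  have M: "finite_measure ?M" by (rule finite_measure_lebesgue_on[OF W])
  interpret M: finite_measure ?M by fact
  have spM: "space ?M = W" using Ws by simp
  have measM: "measure ?M B = measure lebesgue B" if "B \<subseteq> W" for B
    using that Ws by (simp add: measure_restrict_space)
  define A where "A = {p \<in> space (?M \<Otimes>\<^sub>M P). loss (snd (snd p)) (h (fst p) (fst (snd p))) = 0}"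
  have lm[measurable]: "(\<lambda>p. loss (snd (snd p)) (h (fst p) (fst (snd p)))) \<in> borel_measurable (?M \<Otimes>\<^sub>M P)"
    using assms(5) by (simp add: case_prod_beta')
  have A: "A \<in> sets (?M \<Otimes>\<^sub>M P)" unfolding A_def by measurable
  \<comment> \<open>The 0-1 loss of \<open>w\<close> is the indicator of the complement of the
    section of \<open>A\<close>, so the true error is the probability of a misfit.\<close>
  have prob_fit: "measure P (Pair w -` A) = 1 - ?E w" if w: "w \<in> W" for w
  proof -
    have "?E w = (LINT z|P. indicator (space P - Pair w -` A) z)"
      unfolding true_error_def
      using w by (intro Bochner_Integration.integral_cong) (auto simp: A_def spM space_pair_measure loss_def indicator_def)
    also have "\<dots> = measure P (space P - Pair w -` A)"
      using sets_Pair1[OF A] by (simp add: sets.compl_sets)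
    also have "\<dots> = 1 - measure P (Pair w -` A)"
      by (rule P.prob_compl[OF sets_Pair1[OF A]])
    finally show ?thesis by simp
  qed
  have range: "0 \<le> ?E w \<and> ?E w \<le> 1" if "w \<in> W" for w
    using prob_fit[OF that] P.prob_le_1[of "Pair w -` A"] measure_nonneg[of P "Pair w -` A"] by linarith
  have Em[measurable]: "?E \<in> borel_measurable ?M" using assms(6) by simp
  \<comment> \<open>As the minimum is attained, \<open>?m\<close> is the error of some parameter and
    hence nonnegative.\<close>
  have m: "0 \<le> ?m" "?m < 1" using assms(7,10,11) range by (metis, linarith)
  have bad_eq: "bad_params P h W e = {w \<in> W. ?m + e \<le> ?E w}" for e
    by (auto simp: bad_params_def)
  have bad: "bad_params P h W e \<in> sets ?M" for e
  proof -
    have "{w \<in> space ?M. ?m + e \<le> ?E w} \<in> sets ?M" by measurable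
    then show ?thesis by (simp add: bad_eq spM)
  qed
  have WM: "W \<in> sets ?M" using spM sets.top[of ?M] by simp
  \<comment> \<open>The two conditions place each pair \<open>(w, S i)\<close> with
    \<open>i < n\<close> in the product space, where membership in \<open>A\<close> is just zero
    loss.\<close>
  have fit: "{w \<in> B. training_error n h S w = 0} = {w \<in> B. \<forall>i<n. (w, S i) \<in> A}"
    if "S \<in> space ?N" "B \<subseteq> W" for S B
    using that unfolding training_error_eq_0_iff[OF \<open>n \<ge> 1\<close>] A_def sample_dist_def
    by (auto simp: space_pair_measure spM space_PiM PiE_iff)
  \<comment> \<open>Taken with \<open>B = W\<close> this yields the mean of
    \<open>?\<omega>\<close>, and with the bad parameters that of \<open>?\<beta>\<close>.\<close>
  have vol: "(\<lambda>S. measure lebesgue {w \<in> B. training_error n h S w = 0}) \<in> borel_measurable ?N"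
    "(LINT S|?N. measure lebesgue {w \<in> B. training_error n h S w = 0}) = (LINT w:B|?M. (1 - ?E w) ^ n)"
    if B: "B \<in> sets ?M" for B
  proof -
    have BW: "B \<subseteq> W" using sets.sets_into_space[OF B] spM by simp
    have eq: "measure lebesgue {w \<in> B. training_error n h S w = 0}
        = measure ?M {w \<in> B. \<forall>i<n. (w, S i) \<in> A}" if "S \<in> space ?N" for S
      unfolding fit[OF that BW, symmetric] using BW by (intro measM[symmetric]) auto
    note F = integral_measure_common_fit[OF M \<open>prob_space P\<close> A B, of n, folded sample_dist_def]
    show "(\<lambda>S. measure lebesgue {w \<in> B. training_error n h S w = 0}) \<in> borel_measurable ?N"
      using F(1) by (subst measurable_cong[OF eq])
    have "(LINT S|?N. measure lebesgue {w \<in> B. training_error n h S w = 0})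
        = (LINT w:B|?M. measure P (Pair w -` A) ^ n)"
      unfolding F(2)[symmetric] by (intro Bochner_Integration.integral_cong eq refl)
    also have "\<dots> = (LINT w:B|?M. (1 - ?E w) ^ n)"
      using B BW by (intro set_lebesgue_integral_cong) (auto simp: prob_fit)
    finally show "(LINT S|?N. measure lebesgue {w \<in> B. training_error n h S w = 0}) = (LINT w:B|?M. (1 - ?E w) ^ n)" .
  qed
  have \<omega>_eq: "?\<omega> = (\<lambda>S. measure lebesgue {w \<in> W. training_error n h S w = 0})"
    by (simp add: minima_volume_def global_minima_def fun_eq_iff)
  have \<beta>_eq: "?\<beta> = (\<lambda>S. measure lebesgue {w \<in> bad_params P h W \<epsilon>. training_error n h S w = 0})"
    by (simp add: bad_minima_volume_def bad_global_minima_def fun_eq_iff)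
  have [measurable]: "?\<omega> \<in> borel_measurable ?N" "?\<beta> \<in> borel_measurable ?N"
    using vol(1)[OF WM] vol(1)[OF bad] by (simp_all add: \<omega>_eq \<beta>_eq)
  have \<phi>_eq: "?\<phi> = (\<lambda>S. ?\<beta> S / ?\<omega> S)" by (simp add: bad_minima_fraction_def fun_eq_iff)
  have [measurable]: "?\<phi> \<in> borel_measurable ?N" unfolding \<phi>_eq by measurable
  have bounds: "0 \<le> ?\<beta> S" "?\<beta> S \<le> ?\<omega> S" "?\<omega> S \<le> measure lebesgue W" if S: "S \<in> space ?N" for S
  proof -
    \<comment> \<open>Monotonicity of \<open>measure\<close> requires the larger set to be
      measurable. Here it is a finite intersection of sections of \<open>A\<close> at the examples
      \<open>S i\<close>.\<close>
    have s: "{w \<in> W. training_error n h S w = 0} \<in> sets ?M"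
    proof -
      have "(\<lambda>w. (w, S i)) \<in> measurable ?M (?M \<Otimes>\<^sub>M P)" if "i < n" for i
        using S that unfolding sample_dist_def
        by (intro measurable_Pair measurable_ident_sets measurable_const refl) (auto simp: space_PiM PiE_iff)
      then have "{w \<in> space ?M. (w, S i) \<in> A} \<in> sets ?M" if "i < n" for i
        using that A by measurable
      then have "{w \<in> space ?M. \<forall>i\<in>{..<n}. (w, S i) \<in> A} \<in> sets ?M"
        by (intro sets.sets_Collect_finite_All) auto
      then show ?thesis
        unfolding fit[OF S order_refl] spM Ball_def lessThan_iff .
    qed
    have "measure ?M {w \<in> bad_params P h W \<epsilon>. training_error n h S w = 0}
        \<le> measure ?M {w \<in> W. training_error n h S w = 0}"
      using s by (intro M.finite_measure_mono) (auto simp: bad_eq)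
    then show "?\<beta> S \<le> ?\<omega> S"
      unfolding \<omega>_eq \<beta>_eq by (subst (asm) (1 2) measM) (auto simp: bad_eq)
    have "measure ?M {w \<in> W. training_error n h S w = 0} \<le> measure ?M W"
      using WM by (intro M.finite_measure_mono) auto
    then show "?\<omega> S \<le> measure lebesgue W"
      unfolding \<omega>_eq by (subst (asm) (1 2) measM) auto
    show "0 \<le> ?\<beta> S" by (simp add: \<beta>_eq)
  qed
  \<comment> \<open>Where \<open>?\<omega> S = 0\<close>, the bounds force
    \<open>?\<beta> S = 0\<close>, and the value 0 of the quotient agrees with all three
    claims.\<close>
  have \<phi>_bounds: "0 \<le> ?\<phi> S" "?\<phi> S \<le> 1" "?\<phi> S * ?\<omega> S = ?\<beta> S" if "S \<in> space ?N" for S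
    using bounds[OF that] unfolding \<phi>_eq by (auto simp: divide_le_eq_1)
  have int_\<phi>: "integrable ?N ?\<phi>"
  proof (rule N.integrable_const_bound)
    show "AE S in ?N. norm (?\<phi> S) \<le> 1"
      using \<phi>_bounds(1,2) by (intro AE_I2) simp
  qed measurable
  define Num where "Num = (LINT w:bad_params P h W \<epsilon>|?M. (1 - ?E w) ^ n)"
  define Den where "Den = (LINT w:W|?M. (1 - ?E w) ^ n)"
  have N\<omega>: "(LINT S|?N. ?\<omega> S) = Den"
    unfolding Den_def \<omega>_eq by (rule vol(2)[OF WM])
  have "(LINT S|?N. ?\<phi> S * ?\<omega> S) = (LINT S|?N. ?\<beta> S)"
    by (intro Bochner_Integration.integral_cong \<phi>_bounds refl)
  also have "\<dots> = Num"
    unfolding Num_def \<beta>_eq by (rule vol(2)[OF bad])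
  finally have corr: "(LINT S|?N. ?\<phi> S) * Den \<le> Num"
    using assms(14) N\<omega> by simp
  \<comment> \<open>On \<open>?G\<close> the error is below \<open>?m + \<epsilon> / 2\<close>,
    while bad parameters have error at least \<open>?m + \<epsilon>\<close>. The gap of
    \<open>\<epsilon> / 2\<close> produces the exponential factor.\<close>
  let ?G = "W - bad_params P h W (\<epsilon> / 2)"
  let ?g = "good_fraction P h W (\<epsilon> / 2)"
  let ?\<Omega> = "measure lebesgue W"
  have \<Omega>: "?\<Omega> > 0" using assms(3) by (simp add: zero_less_measure_iff)
  have G: "?G \<in> sets ?M" using WM bad by auto
  have mG: "measure ?M ?G = ?g * ?\<Omega>"
  proof -
    have "measure ?M ?G = measure ?M W - measure ?M (bad_params P h W (\<epsilon> / 2))"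
      using WM bad by (intro M.finite_measure_Diff) (auto simp: bad_eq)
    also have "\<dots> = ?\<Omega> - measure lebesgue (bad_params P h W (\<epsilon> / 2))"
      by (simp add: measM bad_eq)
    finally show ?thesis using \<Omega> by (simp add: good_fraction_def)
  qed
  let ?c = "1 - ?m - \<epsilon> / 2"
  have c: "?c > 0" using assms(10,11) by simp
  have "Num \<le> (1 - (?m + \<epsilon>)) ^ n * measure ?M (bad_params P h W \<epsilon>)"
    unfolding Num_def using range by (intro set_integral_power_le[OF M Em _ bad]) (auto simp: spM bad_eq)
  also have "\<dots> \<le> (1 - ?m - \<epsilon>) ^ n * ?\<Omega>"
  proof -
    have "measure ?M (bad_params P h W \<epsilon>) \<le> measure ?M W"
      using WM by (intro M.finite_measure_mono) (auto simp: bad_eq)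
    then show ?thesis
      using assms(11) measM[of W] by (intro mult_mono) (auto simp: algebra_simps)
  qed
  \<comment> \<open>\<open>power_shift_le_exp\<close> with \<open>a = 1 - ?m\<close>. It brings out
    the factor \<open>?c ^ n\<close> that also occurs in the lower bound for
    \<open>Den\<close>.\<close>
  also have "\<dots> \<le> (?c ^ n * exp (- (\<epsilon> / 2) * real n)) * ?\<Omega>"
    using assms(10,11) m \<Omega> by (intro mult_right_mono power_shift_le_exp) auto
  finally have Num_le: "Num \<le> ?c ^ n * exp (- (\<epsilon> / 2) * real n) * ?\<Omega>" .
  have "?c ^ n * (?g * ?\<Omega>) = (1 - (?m + \<epsilon> / 2)) ^ n * measure ?M ?G"
    by (simp add: mG algebra_simps)
  also have "\<dots> \<le> (LINT w:?G|?M. (1 - ?E w) ^ n)"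
    using range c by (intro set_integral_power_ge[OF M Em _ G]) (auto simp: spM bad_eq)
  \<comment> \<open>The integrand is nonnegative, so enlarging the domain from \<open>?G\<close> to
    \<open>W\<close> only adds to the integral.\<close>
  also have "\<dots> \<le> Den"
    using set_integrable_power[OF M Em _ G, of n] set_integrable_power[OF M Em _ WM, of n] range
    unfolding Den_def set_lebesgue_integral_def set_integrable_def
    by (intro integral_mono) (auto simp: spM indicator_def)
  finally have Den_ge: "?c ^ n * (?g * ?\<Omega>) \<le> Den" .
  have Den_pos: "Den > 0"
    using Den_ge c \<Omega> assms(12) by (intro less_le_trans[OF _ Den_ge]) simp

  have "measure ?N {S \<in> space ?N. \<gamma> \<le> ?\<phi> S} \<le> (LINT S|?N. ?\<phi> S) / \<gamma>"
    using int_\<phi> \<phi>_bounds(1) \<open>\<gamma> > 0\<close>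
    by (intro integral_Markov_inequality_measure[where A="{}"] AE_I2) auto
  also have "\<dots> \<le> (Num / Den) / \<gamma>"
    using corr Den_pos \<open>\<gamma> > 0\<close> by (intro divide_right_mono) (auto simp: pos_le_divide_eq)
  finally have first: "measure ?N {S \<in> space ?N. \<gamma> \<le> ?\<phi> S} \<le> 1 / \<gamma> * (Num / Den)"
    by (simp add: mult.commute)

  \<comment> \<open>The common factors \<open>?c ^ n\<close> and \<open>?\<Omega>\<close> are
    positive and cancel, leaving the exponential over the good fraction.\<close>
  have "Num / Den \<le> (?c ^ n * exp (- (\<epsilon> / 2) * real n) * ?\<Omega>) / (?c ^ n * (?g * ?\<Omega>))"
    using Num_le Den_ge c \<Omega> assms(12) by (intro frac_le) auto
  also have "\<dots> = exp (- (\<epsilon> / 2) * real n) / ?g"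
    using c \<Omega> by simp
  finally have "1 / \<gamma> * (Num / Den) \<le> 1 / \<gamma> * (exp (- (\<epsilon> / 2) * real n) / ?g)"
    using \<open>\<gamma> > 0\<close> by (intro mult_left_mono) auto
  then have second: "1 / \<gamma> * (Num / Den) \<le> 1 / (\<gamma> * ?g) * exp (- (\<epsilon> / 2) * real n)"
    by simp

  \<comment> \<open>True errors lie in \<open>{0..1}\<close>, so the upper endpoint 1 excludes no
    parameter and the two density integrals are \<open>Num\<close> and \<open>Den\<close>.\<close>
  have "{w \<in> W. ?E w \<in> {?m + \<epsilon>..1}} = bad_params P h W \<epsilon>"
    "{w \<in> W. ?E w \<in> {0..1}} = W"
    using range by (auto simp: bad_eq)
  then have "(LINT E:{?m + \<epsilon>..1}|classifier_density P h W. (1 - E) ^ n) = Num"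
    "(LINT E:{0..1}|classifier_density P h W. (1 - E) ^ n) = Den"
    using set_integral_classifier_density[OF Em _ _ Ws, of "\<lambda>E. (1 - E) ^ n"]
    by (simp_all add: Num_def Den_def)
  then show ?thesis
    using first second by simp
qed

end
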